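(* Let $A=(a_{ij})_{i,j\in I}$ be a generalized Cartan matrix and $U=(u_{ij})_{i,j\in I}$ a complex matrix satisfying: (0) $u_{jj}=0$ for all $j$; (1) $u_{ij}=u_{ji}=0$ if $a_{ij}=a_{ji}=0$; (2) $u_{ij}=-k\,u_{ji}$ if $(a_{ij},a_{ji})=(-k,-1)$ with $k\in\{1,2,3\}$. Let $\mathbb{C}(\alpha;f;\tau)$ be the field of rational functions in independent variables $\alpha_j,f_j,\tau_j$ ($j\in I$). For each $i\in I$ let $s_i$ be the $\mathbb{C}$-automorphism of $\mathbb{C}(\alpha;f;\tau)$ given by $$s_i(\alpha_j)=\alpha_j-a_{ij}\alpha_i,\quad s_i(f_j)=f_j+\frac{\alpha_i}{f_i}u_{ij},\quad s_i(\tau_j)=\tau_j\ (j\neq i),\quad s_i(\tau_i)=f_i\,\tau_i\prod_{k\in I}\tau_k^{-a_{ki}}=f_i\,\frac{\prod_{k\in I\setminus\{i\}}\tau_k^{|a_{ki}|}}{\tau_i}.$$ Then these automorphisms define a representation of the Coxeter group $W(A)$ on $\mathbb{C}(\alpha;f;\tau)$, i.e. $s_i^2=\mathrm{id}$ and $(s_is_j)^{m_{ij}}=\mathrm{id}$ for $i\neq j$ with $m_{ij}<\infty$.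
   Context: A generalized Cartan matrix $A=(a_{ij})_{i,j\in I}$ ($I$ finite) is an integer matrix with $a_{jj}=2$, $a_{ij}\le 0$ for $i\ne j$, and $a_{ij}=0\iff a_{ji}=0$. The Coxeter group $W(A)$ is generated by $s_i$ ($i\in I$) with relations $s_i^2=1$ and $(s_is_j)^{m_{ij}}=1$ for $i\neq j$, where $m_{ij}=2,3,4,6,\infty$ according as $a_{ij}a_{ji}=0,1,2,3,\ge4$ (no relation when $m_{ij}=\infty$). *)

theory Defs
  imports Complex_Main "HOL-Library.Poly_Mapping" "HOL-Library.Product_Lexorder"
    "HOL-Computational_Algebra.Fraction_Field"
begin

definition gcm :: "('i \<Rightarrow> 'i \<Rightarrow> int) \<Rightarrow> bool" where
  "gcm A \<longleftrightarrow> (\<forall>j. A j j = 2) \<and> (\<forall>i j. i \<noteq> j \<longrightarrow> A i j \<le> 0)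
     \<and> (\<forall>i j. A i j = 0 \<longleftrightarrow> A j i = 0)"

text \<open>Coxeter exponent m_ij for i \<noteq> j: None encodes m_ij = infinity.\<close>
definition coxeter_m :: "('i \<Rightarrow> 'i \<Rightarrow> int) \<Rightarrow> 'i \<Rightarrow> 'i \<Rightarrow> nat option" where
  "coxeter_m A i j =
     (let p = A i j * A j i in
      if p = 0 then Some 2 else if p = 1 then Some 3 else if p = 2 then Some 4
      else if p = 3 then Some 6 else None)"

datatype vkind = Alpha | Fv | Tau

definition vkind_nat :: "vkind \<Rightarrow> nat" where
  "vkind_nat k = (case k of Alpha \<Rightarrow> 0 | Fv \<Rightarrow> 1 | Tau \<Rightarrow> 2)"

lemma inj_vkind_nat: "inj vkind_nat"
  by (auto simp: inj_def vkind_nat_def split: vkind.splits)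

instantiation vkind :: linorder
begin
definition "less_eq_vkind x y \<longleftrightarrow> vkind_nat x \<le> vkind_nat y"
definition "less_vkind x y \<longleftrightarrow> vkind_nat x < vkind_nat y"
instance
proof
  fix x y z :: vkind
  show "x < y \<longleftrightarrow> x \<le> y \<and> \<not> y \<le> x" by (auto simp: less_eq_vkind_def less_vkind_def)
  show "x \<le> x" by (simp add: less_eq_vkind_def)
  show "x \<le> y \<Longrightarrow> y \<le> z \<Longrightarrow> x \<le> z" by (simp add: less_eq_vkind_def)
  show "x \<le> y \<Longrightarrow> y \<le> x \<Longrightarrow> x = y"
    using inj_vkind_nat by (simp add: less_eq_vkind_def inj_eq)
  show "x \<le> y \<or> y \<le> x" by (auto simp: less_eq_vkind_def)
qed
end

text \<open>Variables: alpha_j = (Alpha, j), f_j = (Fv, j), tau_j = (Tau, j).\<close>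
type_synonym 'i var = "vkind \<times> 'i"

type_synonym 'i mpoly = "('i var \<Rightarrow>\<^sub>0 nat) \<Rightarrow>\<^sub>0 complex"
type_synonym 'i ratfun = "'i mpoly fract"

definition rconst :: "complex \<Rightarrow> ('i::linorder) ratfun" where
  "rconst c = Fract (Poly_Mapping.single 0 c) 1"

definition rvar :: "'i var \<Rightarrow> ('i::linorder) ratfun" where
  "rvar v = Fract (Poly_Mapping.single (Poly_Mapping.single v 1) 1) 1"

definition peval :: "('i var \<Rightarrow> ('i::linorder) ratfun) \<Rightarrow> 'i mpoly \<Rightarrow> 'i ratfun" where
  "peval \<sigma> p = (\<Sum>mon\<in>Poly_Mapping.keys p. rconst (Poly_Mapping.lookup p mon) *
      (\<Prod>v\<in>Poly_Mapping.keys (mon :: 'i var \<Rightarrow>\<^sub>0 nat). \<sigma> v ^ Poly_Mapping.lookup mon v))"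

definition rsubst :: "('i var \<Rightarrow> ('i::linorder) ratfun) \<Rightarrow> 'i ratfun \<Rightarrow> 'i ratfun" where
  "rsubst \<sigma> x = (SOME y. \<exists>a b. b \<noteq> 0 \<and> x = Fract a b \<and> y = peval \<sigma> a / peval \<sigma> b)"

definition s_img :: "('i::{finite,linorder} \<Rightarrow> 'i \<Rightarrow> int) \<Rightarrow> ('i \<Rightarrow> 'i \<Rightarrow> complex)
    \<Rightarrow> 'i \<Rightarrow> 'i var \<Rightarrow> 'i ratfun" where
  "s_img A U i v = (case v of
     (Alpha, j) \<Rightarrow> rvar (Alpha, j) - of_int (A i j) * rvar (Alpha, i)
   | (Fv, j) \<Rightarrow> rvar (Fv, j) + rvar (Alpha, i) / rvar (Fv, i) * rconst (U i j)
   | (Tau, j) \<Rightarrow> (if j \<noteq> i then rvar (Tau, j)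
                 else rvar (Fv, i) * rvar (Tau, i) * (\<Prod>k\<in>UNIV. rvar (Tau, k) powi (- A k i))))"

definition s_aut :: "('i::{finite,linorder} \<Rightarrow> 'i \<Rightarrow> int) \<Rightarrow> ('i \<Rightarrow> 'i \<Rightarrow> complex)
    \<Rightarrow> 'i \<Rightarrow> 'i ratfun \<Rightarrow> 'i ratfun" where
  "s_aut A U i = rsubst (s_img A U i)"

end

(* A substitution sigma of variables extends to the rational function field as soon as it kills no
   nonzero polynomial. The relation has_value records the evaluations that avoid zero denominators;
   it is functional and compatible with the field operations, so s_i(s_i(v)) = v on the variables
   already forces both the injectivity of s_i on polynomials and s_i o s_i = id.

   For the braid relations write w_n for the word s_i s_j s_i ... with n letters. The product
   z_n = w_n(f_i) w_n(f_j) changes in every step by a constant multiple of a root, and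
   w_{n+1}(f_i) = w_n(f_i) z_{n+1} / z_n whenever the last letter is s_j. Hence all w_n(f) and
   w_n(tau) for f and tau with index i or j are Laurent monomials in f_i, the tau and the z_n. Each
   z_n is z_0 plus a linear form in alpha_i and alpha_j, and coincidences among the z_n close the
   orbit after 2 m_ij steps. The images of the remaining f_l and alpha_l are governed by the
   accumulated sums of w_n(alpha)/w_n(f) and of w_n(alpha), which have to vanish. *)
theory Submission
  imports Defs
begin

section \<open>Substitutions in rational functions\<close>

definition mon_eval :: "('i var \<Rightarrow> ('i::linorder) ratfun) \<Rightarrow> ('i var \<Rightarrow>\<^sub>0 nat) \<Rightarrow> 'i ratfun" where
  "mon_eval \<sigma> m = (\<Prod>v\<in>Poly_Mapping.keys m. \<sigma> v ^ Poly_Mapping.lookup m v)"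

text \<open>Extra variables carry exponent 0. A common index set makes monomials with different
  supports comparable factor by factor.\<close>

lemma mon_eval_superset:
  assumes "finite S" "Poly_Mapping.keys m \<subseteq> S"
  shows "mon_eval \<sigma> m = (\<Prod>v\<in>S. \<sigma> v ^ Poly_Mapping.lookup m v)"
  unfolding mon_eval_def using assms
  by (intro prod.mono_neutral_left) (auto simp: in_keys_iff)

lemma mon_eval_0 [simp]: "mon_eval \<sigma> 0 = 1"
  by (simp add: mon_eval_def)

lemma mon_eval_add: "mon_eval \<sigma> (m + n) = mon_eval \<sigma> m * mon_eval \<sigma> n"
proof -
  let ?S = "Poly_Mapping.keys m \<union> Poly_Mapping.keys n"
  have "mon_eval \<sigma> (m + n) = (\<Prod>v\<in>?S. \<sigma> v ^ Poly_Mapping.lookup (m + n) v)"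
    by (rule mon_eval_superset) (auto simp: Poly_Mapping.keys_add)
  also have "\<dots> = (\<Prod>v\<in>?S. \<sigma> v ^ Poly_Mapping.lookup m v) * (\<Prod>v\<in>?S. \<sigma> v ^ Poly_Mapping.lookup n v)"
    by (simp add: lookup_add power_add prod.distrib)
  also have "\<dots> = mon_eval \<sigma> m * mon_eval \<sigma> n"
    by (simp add: mon_eval_superset[of ?S])
  finally show ?thesis .
qed

lemma rconst_0 [simp]: "rconst 0 = 0"
  by (simp add: rconst_def fract_collapse)

lemma rconst_1 [simp]: "rconst 1 = 1"
  by (simp add: rconst_def fract_collapse)

lemma rconst_add: "rconst (c + d) = rconst c + rconst d"
  by (simp add: rconst_def single_add)

lemma rconst_mult: "rconst (c * d) = rconst c * rconst d"
  by (simp add: rconst_def mult_single)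

lemma rconst_minus: "rconst (- c) = - rconst c"
  by (simp add: rconst_def single_uminus)

text \<open>Cancellation may shrink the support of a sum of polynomials, so additivity is checked
  over the union of the supports, where missing coefficients count as 0.\<close>

lemma peval_superset:
  assumes "finite S" "Poly_Mapping.keys p \<subseteq> S"
  shows "peval \<sigma> p = (\<Sum>m\<in>S. rconst (Poly_Mapping.lookup p m) * mon_eval \<sigma> m)"
  unfolding peval_def mon_eval_def using assms
  by (intro sum.mono_neutral_left) (auto simp: in_keys_iff)

lemma peval_0 [simp]: "peval \<sigma> 0 = 0"
  by (simp add: peval_def)

lemma peval_single: "peval \<sigma> (Poly_Mapping.single m c) = rconst c * mon_eval \<sigma> m"
  by (simp add: peval_superset[of "{m}"])

lemma peval_1 [simp]: "peval \<sigma> 1 = 1"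
  by (simp add: peval_single flip: single_one)

lemma peval_add: "peval \<sigma> (p + q) = peval \<sigma> p + peval \<sigma> q"
proof -
  let ?S = "Poly_Mapping.keys p \<union> Poly_Mapping.keys q"
  have "peval \<sigma> (p + q) = (\<Sum>m\<in>?S. rconst (Poly_Mapping.lookup (p + q) m) * mon_eval \<sigma> m)"
    by (rule peval_superset) (auto simp: Poly_Mapping.keys_add)
  also have "\<dots> = peval \<sigma> p + peval \<sigma> q"
    by (simp add: lookup_add rconst_add distrib_right sum.distrib peval_superset[of ?S])
  finally show ?thesis .
qed

lemma peval_minus: "peval \<sigma> (- p) = - peval \<sigma> p"
  using peval_add[of \<sigma> p "- p"] by (simp add: eq_neg_iff_add_eq_0 add.commute)

text \<open>Polynomials and monomials are both finitely supported maps, so one induction serves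
  both. The step asks for no freshness of the key, which additive statements can afford.\<close>

lemma poly_mapping_add_induct [case_names zero add_single]:
  fixes p :: "'a \<Rightarrow>\<^sub>0 'b::comm_monoid_add"
  assumes "P 0" "\<And>p k v. P p \<Longrightarrow> P (Poly_Mapping.single k v + p)"
  shows "P p"
proof -
  have "P (\<Sum>k\<in>S. Poly_Mapping.single k (Poly_Mapping.lookup p k))" if "finite S" for S
    using that by (induction S rule: finite_induct) (auto intro: assms)
  moreover have "(\<Sum>k\<in>Poly_Mapping.keys p. Poly_Mapping.single k (Poly_Mapping.lookup p k)) = p"
    by (rule poly_mapping_eqI) (auto simp: lookup_sum lookup_single when_def in_keys_iff)
  ultimately show ?thesis
    using finite_keys by metis
qed

text \<open>Both sides are additive in each factor, so two inductions leave a product of two single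
  terms, where exponents add.\<close>

lemma peval_mult: "peval \<sigma> (p * q) = peval \<sigma> p * peval \<sigma> q"
proof (induction p rule: poly_mapping_add_induct)
  case (add_single p m c)
  have "peval \<sigma> (Poly_Mapping.single m c * q) = peval \<sigma> (Poly_Mapping.single m c) * peval \<sigma> q"
  proof (induction q rule: poly_mapping_add_induct)
    case (add_single q n d)
    then show ?case
      by (simp add: distrib_left peval_add mult_single peval_single rconst_mult mon_eval_add)
  qed simp
  with add_single show ?case
    by (simp add: distrib_right peval_add)
qed simp

lemma mon_eval_rvar: "mon_eval rvar m = Fract (Poly_Mapping.single m 1) 1"
proof (induction m rule: poly_mapping_add_induct)
  case zero
  then show ?case by (simp add: One_fract_def)
next
  case (add_single p v n)
  have "mon_eval rvar (Poly_Mapping.single v n) = rvar v ^ n"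
    by (simp add: mon_eval_superset[of "{v}"])
  also have "\<dots> = Fract (Poly_Mapping.single (Poly_Mapping.single v n) 1) 1"
  proof (induction n)
    case 0
    then show ?case by (simp add: One_fract_def)
  next
    case (Suc n)
    then show ?case
      by (simp add: rvar_def mult_single flip: single_add)
  qed
  finally show ?case
    by (simp add: mon_eval_add add_single mult_single)
qed

text \<open>Substituting every variable for itself is the embedding of polynomials into fractions.
  This form lets a twofold substitution be recognised as the identity.\<close>

lemma peval_rvar: "peval rvar p = Fract p 1"
proof (induction p rule: poly_mapping_add_induct)
  case zero
  then show ?case by (simp add: Zero_fract_def)
next
  case (add_single p m c)
  then show ?case
    by (simp add: peval_add peval_single mon_eval_rvar rconst_def mult_single)
qed

section \<open>Partial evaluation of rational functions\<close>

definition has_value :: "('i var \<Rightarrow> ('i::linorder) ratfun) \<Rightarrow> 'i ratfun \<Rightarrow> 'i ratfun \<Rightarrow> bool" where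
  "has_value \<sigma> x y \<longleftrightarrow> (\<exists>a b. peval \<sigma> b \<noteq> 0 \<and> x = Fract a b \<and> y = peval \<sigma> a / peval \<sigma> b)"

text \<open>Two fractions representing \<open>x\<close> give a polynomial identity after cross
  multiplication. \<open>peval\<close> preserves it, and dividing back is legitimate because both
  denominators have nonzero value.\<close>

lemma has_value_unique:
  assumes "has_value \<sigma> x y" "has_value \<sigma> x y'"
  shows "y = y'"
proof -
  obtain a b a' b' where *: "peval \<sigma> b \<noteq> 0" "peval \<sigma> b' \<noteq> 0" "Fract a b = Fract a' b'"
      "y = peval \<sigma> a / peval \<sigma> b" "y' = peval \<sigma> a' / peval \<sigma> b'"
    using assms unfolding has_value_def by metis
  then have "b \<noteq> 0" "b' \<noteq> 0" by auto
  with * have "a * b' = a' * b" by (simp add: eq_fract)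
  then have "peval \<sigma> a * peval \<sigma> b' = peval \<sigma> a' * peval \<sigma> b"
    by (simp flip: peval_mult)
  with * show ?thesis by (simp add: frac_eq_eq)
qed

lemma has_value_Fract_1: "has_value \<sigma> (Fract p 1) (peval \<sigma> p)"
  unfolding has_value_def by (rule exI[of _ p], rule exI[of _ 1]) simp

lemma has_value_rconst: "has_value \<sigma> (rconst c) (rconst c)"
  using has_value_Fract_1[of \<sigma> "Poly_Mapping.single 0 c"] by (simp add: peval_single rconst_def)

lemma has_value_0: "has_value \<sigma> 0 0"
  using has_value_rconst[of \<sigma> 0] by simp

lemma has_value_1: "has_value \<sigma> 1 1"
  using has_value_rconst[of \<sigma> 1] by simp

lemma has_value_rvar: "has_value \<sigma> (rvar v) (\<sigma> v)"
  using has_value_Fract_1[of \<sigma> "Poly_Mapping.single (Poly_Mapping.single v 1) 1"]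
  by (simp add: peval_single rvar_def mon_eval_superset[of "{v}"])

lemma has_value_add:
  assumes "has_value \<sigma> x y" "has_value \<sigma> x' y'"
  shows "has_value \<sigma> (x + x') (y + y')"
proof -
  obtain a b a' b' where *: "peval \<sigma> b \<noteq> 0" "peval \<sigma> b' \<noteq> 0" "x = Fract a b" "x' = Fract a' b'"
      "y = peval \<sigma> a / peval \<sigma> b" "y' = peval \<sigma> a' / peval \<sigma> b'"
    using assms unfolding has_value_def by metis
  then have "b \<noteq> 0" "b' \<noteq> 0" by auto
  with * show ?thesis
    unfolding has_value_def
    by (intro exI[of _ "a * b' + a' * b"] exI[of _ "b * b'"])
       (simp add: peval_add peval_mult add_frac_eq)
qed

lemma has_value_minus:
  assumes "has_value \<sigma> x y"
  shows "has_value \<sigma> (- x) (- y)"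
  using assms unfolding has_value_def by (metis minus_fract minus_divide_left peval_minus)

lemma has_value_diff:
  "has_value \<sigma> x y \<Longrightarrow> has_value \<sigma> x' y' \<Longrightarrow> has_value \<sigma> (x - x') (y - y')"
  using has_value_add[of \<sigma> x y "- x'" "- y'"] has_value_minus by fastforce

lemma has_value_mult:
  assumes "has_value \<sigma> x y" "has_value \<sigma> x' y'"
  shows "has_value \<sigma> (x * x') (y * y')"
proof -
  obtain a b a' b' where *: "peval \<sigma> b \<noteq> 0" "peval \<sigma> b' \<noteq> 0" "x = Fract a b" "x' = Fract a' b'"
      "y = peval \<sigma> a / peval \<sigma> b" "y' = peval \<sigma> a' / peval \<sigma> b'"
    using assms unfolding has_value_def by metis
  then show ?thesis
    unfolding has_value_def
    by (intro exI[of _ "a * a'"] exI[of _ "b * b'"]) (simp add: peval_mult)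
qed

lemma has_value_inverse:
  assumes "has_value \<sigma> x y" "y \<noteq> 0"
  shows "has_value \<sigma> (inverse x) (inverse y)"
proof -
  obtain a b where *: "peval \<sigma> b \<noteq> 0" "x = Fract a b" "y = peval \<sigma> a / peval \<sigma> b"
    using assms unfolding has_value_def by metis
  then show ?thesis
    using assms(2) unfolding has_value_def
    by (intro exI[of _ b] exI[of _ a]) auto
qed

lemma has_value_divide:
  "has_value \<sigma> x y \<Longrightarrow> has_value \<sigma> x' y' \<Longrightarrow> y' \<noteq> 0 \<Longrightarrow> has_value \<sigma> (x / x') (y / y')"
  by (simp add: divide_inverse has_value_mult has_value_inverse)

lemma has_value_power: "has_value \<sigma> x y \<Longrightarrow> has_value \<sigma> (x ^ n) (y ^ n)"
  by (induction n) (auto intro: has_value_1 has_value_mult)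

lemma has_value_powi:
  "has_value \<sigma> x y \<Longrightarrow> y \<noteq> 0 \<Longrightarrow> has_value \<sigma> (x powi n) (y powi n)"
  by (cases "n \<ge> 0") (auto simp: power_int_def power_inverse intro!: has_value_power has_value_inverse)

lemma has_value_sum:
  "(\<And>k. k \<in> S \<Longrightarrow> has_value \<sigma> (f k) (g k)) \<Longrightarrow> has_value \<sigma> (sum f S) (sum g S)"
  by (induction S rule: infinite_finite_induct) (auto intro: has_value_0 has_value_add)

lemma has_value_prod:
  "(\<And>k. k \<in> S \<Longrightarrow> has_value \<sigma> (f k) (g k)) \<Longrightarrow> has_value \<sigma> (prod f S) (prod g S)"
  by (induction S rule: infinite_finite_induct) (auto intro: has_value_1 has_value_mult)

text \<open>Composition of substitutions: \<open>peval \<rho> p\<close> is built from the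
  \<open>\<rho> v\<close> by field operations, so its value is built in the same way from their
  values.\<close>

lemma has_value_peval:
  assumes "\<And>v. has_value \<sigma> (\<rho> v) (\<rho>' v)"
  shows "has_value \<sigma> (peval \<rho> p) (peval \<rho>' p)"
  unfolding peval_def
  by (intro has_value_sum has_value_mult has_value_prod has_value_power has_value_rconst assms)

lemma of_int_eq_rconst: "of_int n = rconst (of_int n)"
proof -
  have nat: "of_nat m = rconst (of_nat m)" for m
    by (induction m) (simp_all add: rconst_add)
  show ?thesis
    by (cases n rule: int_cases2) (simp_all add: rconst_minus nat)
qed

lemma has_value_of_int: "has_value \<sigma> (of_int n) (of_int n)"
  using has_value_rconst[of \<sigma> "of_int n"] by (simp add: of_int_eq_rconst)

section \<open>Involutive substitutions and the total map \<open>rsubst\<close>\<close>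

locale involutive_substitution =
  fixes \<sigma> :: "'i var \<Rightarrow> ('i::linorder) ratfun"
  assumes involutive: "has_value \<sigma> (\<sigma> v) (rvar v)"
begin

text \<open>Applying the substitution twice returns every polynomial. The relation is used because
  \<open>rsubst\<close> is not yet known to respect fractions.\<close>

lemma has_value_peval_Fract: "has_value \<sigma> (peval \<sigma> p) (Fract p 1)"
  using has_value_peval[of \<sigma> \<sigma> rvar p] involutive by (simp add: peval_rvar)

text \<open>If the first application gives 0, then so does the second; but the second gives
  \<open>p\<close> back.\<close>

lemma peval_eq_0_iff [simp]: "peval \<sigma> p = 0 \<longleftrightarrow> p = 0"
proof
  assume "peval \<sigma> p = 0"
  then have "Fract p 1 = 0"
    using has_value_peval_Fract[of p] has_value_0 has_value_unique by metis
  then show "p = 0" by (simp add: Zero_fract_def eq_fract)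
qed simp

lemma has_value_rsubst: "has_value \<sigma> x (rsubst \<sigma> x)"
proof -
  have "\<exists>y a b. b \<noteq> 0 \<and> x = Fract a b \<and> y = peval \<sigma> a / peval \<sigma> b"
    by (cases x) auto
  from someI_ex[OF this] show ?thesis
    unfolding rsubst_def has_value_def peval_eq_0_iff by simp
qed

lemma rsubst_eqI: "has_value \<sigma> x y \<Longrightarrow> rsubst \<sigma> x = y"
  using has_value_rsubst has_value_unique by metis

lemma rsubst_rsubst: "rsubst \<sigma> (rsubst \<sigma> x) = x"
proof -
  obtain a b where x: "x = Fract a b" "b \<noteq> 0" by (cases x) auto
  then have "rsubst \<sigma> x = peval \<sigma> a / peval \<sigma> b"
    by (intro rsubst_eqI) (auto simp: has_value_def)
  moreover have "has_value \<sigma> (peval \<sigma> a / peval \<sigma> b) (Fract a 1 / Fract b 1)"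
    using x by (intro has_value_divide has_value_peval_Fract) (simp add: Zero_fract_def eq_fract)
  ultimately show ?thesis using x by (simp add: rsubst_eqI)
qed

end

section \<open>Endomorphisms of the rational function field over the constants\<close>

definition ratfun_hom :: "('i::linorder ratfun \<Rightarrow> 'i ratfun) \<Rightarrow> bool" where
  "ratfun_hom w \<longleftrightarrow> (\<forall>c. w (rconst c) = rconst c) \<and> (\<forall>x y. w (x + y) = w x + w y)
     \<and> (\<forall>x y. w (x * y) = w x * w y)"

lemma (in involutive_substitution) ratfun_hom_rsubst: "ratfun_hom (rsubst \<sigma>)"
  unfolding ratfun_hom_def
  by (intro conjI allI rsubst_eqI has_value_rconst has_value_add has_value_mult has_value_rsubst)

context
  fixes w :: "('i::linorder) ratfun \<Rightarrow> 'i ratfun"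
  assumes w: "ratfun_hom w"
begin

lemma hom_rconst: "w (rconst c) = rconst c"
  and hom_add: "w (x + y) = w x + w y"
  and hom_mult: "w (x * y) = w x * w y"
  using w by (auto simp: ratfun_hom_def)

lemma hom_0: "w 0 = 0"
  using hom_rconst[of 0] by simp

lemma hom_1: "w 1 = 1"
  using hom_rconst[of 1] by simp

lemma hom_of_int: "w (of_int n) = of_int n"
  by (simp add: of_int_eq_rconst hom_rconst)

lemma hom_minus: "w (- x) = - w x"
  using hom_add[of x "- x"] by (simp add: hom_0 eq_neg_iff_add_eq_0 add.commute)

lemma hom_diff: "w (x - y) = w x - w y"
  using hom_add[of x "- y"] by (simp add: hom_minus)

lemma hom_eq_0_iff: "w x = 0 \<longleftrightarrow> x = 0"
proof
  assume "w x = 0"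
  show "x = 0"
  proof (rule ccontr)
    assume "x \<noteq> 0"
    then have "w x * w (inverse x) = 1" by (simp add: hom_1 flip: hom_mult)
    with \<open>w x = 0\<close> show False by simp
  qed
qed (simp add: hom_0)

lemma hom_inverse: "w (inverse x) = inverse (w x)"
proof (cases "x = 0")
  case False
  then have "w x * w (inverse x) = 1" by (simp add: hom_1 flip: hom_mult)
  then show ?thesis by (metis inverse_unique)
qed (simp add: hom_0)

lemma hom_divide: "w (x / y) = w x / w y"
  by (simp add: divide_inverse hom_mult hom_inverse)

lemma hom_power: "w (x ^ n) = w x ^ n"
  by (induction n) (simp_all add: hom_1 hom_mult)

lemma hom_powi: "w (x powi n) = w x powi n"
  by (simp add: power_int_def hom_power hom_inverse)

lemma hom_sum: "w (sum f S) = (\<Sum>k\<in>S. w (f k))"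
  by (induction S rule: infinite_finite_induct) (simp_all add: hom_0 hom_add)

lemma hom_prod: "w (prod f S) = (\<Prod>k\<in>S. w (f k))"
  by (induction S rule: infinite_finite_induct) (simp_all add: hom_1 hom_mult)

text \<open>Constants and variables generate the field, so a Coxeter relation only has to be checked
  on single variables.\<close>

lemma hom_eq_id:
  assumes "\<And>v. w (rvar v) = rvar v"
  shows "w = id"
proof
  have *: "w (Fract p 1) = Fract p 1" for p
    by (subst (1 2) peval_rvar[symmetric])
      (simp add: peval_def hom_sum hom_mult hom_rconst hom_prod hom_power assms)
  fix x :: "'i ratfun"
  obtain a b where "x = Fract a b" by (metis Fract_cases)
  then have "x = Fract a 1 / Fract b 1" by simp
  then show "w x = id x" by (simp add: hom_divide * del: divide_fract)
qed

end

section \<open>Closed orbits in rank two\<close>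

text \<open>The values of \<open>w\<^sub>n\<close> at \<open>\<alpha>\<^sub>i, \<alpha>\<^sub>j, f\<^sub>i, f\<^sub>j, \<tau>\<^sub>i, \<tau>\<^sub>j\<close> are \<open>a, b, x, y, t, s\<close>; the accumulated sums
  \<open>E, F, X, Y\<close> are the coefficients of \<open>-a\<^sub>i\<^sub>l, -a\<^sub>j\<^sub>l, u\<^sub>i\<^sub>l, u\<^sub>j\<^sub>l\<close> in the images of \<open>\<alpha>\<^sub>l\<close> and \<open>f\<^sub>l\<close>.\<close>
locale rank_two_orbit =
  fixes k q :: nat and u v M N :: "'a::field" and a b x y E F X Y t s :: "nat \<Rightarrow> 'a"
  assumes init: "E 0 = 0" "F 0 = 0" "X 0 = 0" "Y 0 = 0"
    and nonzero: "\<And>n. x n \<noteq> 0" "\<And>n. y n \<noteq> 0" "\<And>n. t n \<noteq> 0" "\<And>n. s n \<noteq> 0" "M \<noteq> 0" "N \<noteq> 0"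
    and even_step: "even n \<Longrightarrow> a (Suc n) = - a n" "even n \<Longrightarrow> b (Suc n) = b n + of_nat k * a n"
      "even n \<Longrightarrow> x (Suc n) = x n" "even n \<Longrightarrow> y (Suc n) = y n + a n / x n * u"
      "even n \<Longrightarrow> E (Suc n) = E n + a n" "even n \<Longrightarrow> F (Suc n) = F n"
      "even n \<Longrightarrow> X (Suc n) = X n + a n / x n" "even n \<Longrightarrow> Y (Suc n) = Y n"
      "even n \<Longrightarrow> t (Suc n) = x n * M * s n ^ q / t n" "even n \<Longrightarrow> s (Suc n) = s n"
    and odd_step: "odd n \<Longrightarrow> b (Suc n) = - b n" "odd n \<Longrightarrow> a (Suc n) = a n + of_nat q * b n"
      "odd n \<Longrightarrow> y (Suc n) = y n" "odd n \<Longrightarrow> x (Suc n) = x n + b n / y n * v"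
      "odd n \<Longrightarrow> E (Suc n) = E n" "odd n \<Longrightarrow> F (Suc n) = F n + b n"
      "odd n \<Longrightarrow> X (Suc n) = X n" "odd n \<Longrightarrow> Y (Suc n) = Y n + b n / y n"
      "odd n \<Longrightarrow> s (Suc n) = y n * N * t n ^ k / s n" "odd n \<Longrightarrow> t (Suc n) = t n"
begin

text \<open>Each step changes only one of the two factors, by a fraction whose denominator is the
  other one. Multiplying by the unchanged factor clears it, so \<open>z\<close> moves
  linearly.\<close>

definition z :: "nat \<Rightarrow> 'a" where "z n = x n * y n"

text \<open>Only the accumulated sums and the two moving tau occur: through the sums, these
  conditions also control the images of every alpha and f, including those with the two active
  indices.\<close>

definition closed_at :: "nat \<Rightarrow> bool" where
  "closed_at n \<longleftrightarrow> E n = 0 \<and> F n = 0 \<and> X n = 0 \<and> Y n = 0 \<and> t n = t 0 \<and> s n = s 0"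

lemma z_nonzero: "z n \<noteq> 0"
  by (simp add: z_def nonzero)

lemma z_even: "even n \<Longrightarrow> z (Suc n) = z n + a n * u"
  using nonzero by (simp add: z_def even_step field_simps)

lemma z_odd: "odd n \<Longrightarrow> z (Suc n) = z n + b n * v"
  using nonzero by (simp add: z_def odd_step field_simps)

lemma x_odd: "odd n \<Longrightarrow> x (Suc n) = x n * z (Suc n) / z n"
  using nonzero by (simp add: z_def odd_step)

lemma y_eq: "y n = z n / x n"
  using nonzero by (simp add: z_def)

text \<open>The recursion is used as rewriting from numeral indices downwards, up to 12, the longest
  orbit. \<open>One_nat_def\<close> is removed from the simplifier below so that equations at index
  1 still match.\<close>

lemma Suc_nums: "Suc 0 = 1" "Suc 1 = 2" "Suc 2 = 3" "Suc 3 = 4" "Suc 4 = 5" "Suc 5 = 6" "Suc 6 = 7"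
  "Suc 7 = 8" "Suc 8 = 9" "Suc 9 = 10" "Suc 10 = 11" "Suc 11 = 12"
  by simp_all

lemmas linear_even = even_step(1,2,5,6) z_even
lemmas linear_odd = odd_step(1,2,5,6) z_odd

lemmas linear_steps =
  linear_even[of 0, unfolded Suc_nums] linear_odd[of 1, unfolded Suc_nums]
  linear_even[of 2, unfolded Suc_nums] linear_odd[of 3, unfolded Suc_nums]
  linear_even[of 4, unfolded Suc_nums] linear_odd[of 5, unfolded Suc_nums]
  linear_even[of 6, unfolded Suc_nums] linear_odd[of 7, unfolded Suc_nums]
  linear_even[of 8, unfolded Suc_nums] linear_odd[of 9, unfolded Suc_nums]
  linear_even[of 10, unfolded Suc_nums] linear_odd[of 11, unfolded Suc_nums]

lemmas x_steps =
  even_step(3)[of 0, unfolded Suc_nums] x_odd[of 1, unfolded Suc_nums]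
  even_step(3)[of 2, unfolded Suc_nums] x_odd[of 3, unfolded Suc_nums]
  even_step(3)[of 4, unfolded Suc_nums] x_odd[of 5, unfolded Suc_nums]
  even_step(3)[of 6, unfolded Suc_nums] x_odd[of 7, unfolded Suc_nums]
  even_step(3)[of 8, unfolded Suc_nums] x_odd[of 9, unfolded Suc_nums]
  even_step(3)[of 10, unfolded Suc_nums] x_odd[of 11, unfolded Suc_nums]

lemmas XY_even = even_step(7,8)
lemmas XY_odd = odd_step(7,8)

lemmas XY_steps =
  XY_even[of 0, unfolded Suc_nums] XY_odd[of 1, unfolded Suc_nums]
  XY_even[of 2, unfolded Suc_nums] XY_odd[of 3, unfolded Suc_nums]
  XY_even[of 4, unfolded Suc_nums] XY_odd[of 5, unfolded Suc_nums]
  XY_even[of 6, unfolded Suc_nums] XY_odd[of 7, unfolded Suc_nums]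
  XY_even[of 8, unfolded Suc_nums] XY_odd[of 9, unfolded Suc_nums]
  XY_even[of 10, unfolded Suc_nums] XY_odd[of 11, unfolded Suc_nums]

lemmas ts_even = even_step(9,10)
lemmas ts_odd = odd_step(9,10)

lemmas ts_steps =
  ts_even[of 0, unfolded Suc_nums] ts_odd[of 1, unfolded Suc_nums]
  ts_even[of 2, unfolded Suc_nums] ts_odd[of 3, unfolded Suc_nums]
  ts_even[of 4, unfolded Suc_nums] ts_odd[of 5, unfolded Suc_nums]
  ts_even[of 6, unfolded Suc_nums] ts_odd[of 7, unfolded Suc_nums]
  ts_even[of 8, unfolded Suc_nums] ts_odd[of 9, unfolded Suc_nums]
  ts_even[of 10, unfolded Suc_nums] ts_odd[of 11, unfolded Suc_nums]

text \<open>With \<open>u = v = 0\<close> the f stay constant while each root only flips its sign,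
  so the two contributions to each sum cancel.\<close>

lemma closed_A1A1:
  assumes "k = 0" "q = 0" "u = 0" "v = 0"
  shows "closed_at 4"
proof -
  have "x 2 = x 0" "y 1 = y 0" "y 3 = y 0"
    using odd_step(4)[of 1] even_step(4)[of 0] even_step(4)[of 2] odd_step(3)[of 1] even_step(3)[of 0]
    by (simp_all add: assms Suc_nums del: One_nat_def)
  then show ?thesis
    using nonzero assms unfolding closed_at_def
    by (simp add: linear_steps x_steps XY_steps ts_steps init del: One_nat_def)
qed

lemma closed_A2:
  assumes "k = 1" "q = 1" "u = - v"
  shows "closed_at 6"
proof -
  have ab: "a 1 = - a 0" "b 1 = a 0 + b 0" "a 2 = b 0" "b 2 = - a 0 - b 0" "a 3 = - b 0"
    "b 3 = - a 0" "a 4 = - a 0 - b 0" "b 4 = a 0" "a 5 = a 0 + b 0" "b 5 = - b 0"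
    by (simp_all add: linear_steps assms algebra_simps del: One_nat_def)
  have EF: "E 6 = 0" "F 6 = 0"
    by (simp_all add: linear_steps init ab del: One_nat_def)
  have z: "z 1 = z 0 - a 0 * v" "z 2 = z 0 + b 0 * v" "z 3 = z 0" "z 4 = z 1" "z 5 = z 2"
    "z 6 = z 0"
    by (simp_all add: linear_steps ab assms algebra_simps del: One_nat_def)
  \<comment> \<open>Only the coincidences enter the field computations. The remaining
    \<open>z\<close> stay opaque symbols, nonzero by \<open>z_nonzero\<close>, so denominators can
    be cleared.\<close>
  note z_alias = z(3-6)
  \<comment> \<open>The ratios from \<open>x_odd\<close> telescope: the numerator \<open>z 4\<close>
    of one step cancels the denominator \<open>z 1\<close> of an earlier one.\<close>
  have x: "x 1 = x 0" "x 2 = x 0 * z 2 / z 1" "x 3 = x 0 * z 2 / z 1" "x 4 = x 0 * z 2 / z 0"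
    "x 5 = x 0 * z 2 / z 0"
    using z_nonzero nonzero by (simp_all add: x_steps z_alias del: One_nat_def)
  note ts_calc = ts_steps y_eq x z_alias assms field_simps power_numeral_reduce
  \<comment> \<open>\<open>t\<close> moves only at even steps and \<open>s\<close> only at odd ones,
    so \<open>t\<close> at odd and \<open>s\<close> at even indices describe the whole
    orbit.\<close>
  have ts1: "t 1 = x 0 * M * s 0 / t 0"
    using z_nonzero nonzero
    by (simp add: ts_calc del: One_nat_def)
  have ts2: "s 2 = z 1 * N * M / t 0"
    using z_nonzero nonzero
    by (simp add: ts_calc ts1 del: One_nat_def)
  have ts3: "t 3 = z 2 * N * M / s 0"
    using z_nonzero nonzero
    by (simp add: ts_calc ts1 ts2 del: One_nat_def)
  have ts4: "s 4 = z 0 * N * t 0 / (x 0 * s 0)"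
    using z_nonzero nonzero
    by (simp add: ts_calc ts2 ts3 del: One_nat_def)
  have ts5: "t 5 = t 0"
    using z_nonzero nonzero
    by (simp add: ts_calc ts3 ts4 del: One_nat_def)
  have ts6: "s 6 = s 0"
    using z_nonzero nonzero
    by (simp add: ts_calc ts4 ts5 del: One_nat_def)
  \<comment> \<open>Over a common denominator the claim amounts to
    \<open>a 0 * z 2 + b 0 * z 1 = (a 0 + b 0) * z 0\<close>. This needs the linear forms of the
    \<open>z\<close>, inserted only in the second simplification.\<close>
  have X: "X 6 = 0"
    using z_nonzero nonzero
    by (simp add: XY_steps init x ab z_alias field_simps del: One_nat_def)
      (simp add: z algebra_simps del: One_nat_def)
  have Y: "Y 6 = 0"
    using z_nonzero nonzero
    by (simp add: XY_steps init x ab y_eq z_alias field_simps del: One_nat_def)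
      (simp add: z algebra_simps del: One_nat_def)
  show ?thesis
    using EF X Y ts5 ts6 unfolding closed_at_def
    by (simp add: ts_steps del: One_nat_def)
qed

text \<open>Four letters, the longest element, act as -1 on the roots, so the second half of the
  walk cancels the first in \<open>E\<close> and \<open>F\<close>. The walk meets four symbols
  \<open>z 0\<close> to \<open>z 3\<close>.\<close>

lemma closed_B2:
  assumes "k = 2" "q = 1" "u = - 2 * v"
  shows "closed_at 8"
proof -
  have ab: "a 1 = - a 0" "b 1 = 2 * a 0 + b 0" "a 2 = a 0 + b 0" "b 2 = - 2 * a 0 - b 0"
    "a 3 = - a 0 - b 0" "b 3 = b 0" "a 4 = - a 0" "b 4 = - b 0" "a 5 = a 0"
    "b 5 = - 2 * a 0 - b 0" "a 6 = - a 0 - b 0" "b 6 = 2 * a 0 + b 0" "a 7 = a 0 + b 0"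
    "b 7 = - b 0"
    by (simp_all add: linear_steps assms algebra_simps del: One_nat_def)
  have EF: "E 8 = 0" "F 8 = 0"
    by (simp_all add: linear_steps init ab del: One_nat_def)
  have z: "z 1 = z 0 - 2 * a 0 * v" "z 2 = z 0 + b 0 * v" "z 3 = z 0 - 2 * a 0 * v - b 0 * v"
    "z 4 = z 1" "z 5 = z 0" "z 6 = z 3" "z 7 = z 2" "z 8 = z 0"
    by (simp_all add: linear_steps ab assms algebra_simps del: One_nat_def)
  note z_alias = z(4-8)
  have x: "x 1 = x 0" "x 2 = x 0 * z 2 / z 1" "x 3 = x 0 * z 2 / z 1" "x 4 = x 0 * z 2 / z 3"
    "x 5 = x 0 * z 2 / z 3" "x 6 = x 0 * z 2 / z 0" "x 7 = x 0 * z 2 / z 0"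
    using z_nonzero nonzero by (simp_all add: x_steps z_alias del: One_nat_def)
  note ts_calc = ts_steps y_eq x z_alias assms field_simps power_numeral_reduce
  have ts1: "t 1 = x 0 * M * s 0 / t 0"
    using z_nonzero nonzero
    by (simp add: ts_calc del: One_nat_def)
  have ts2: "s 2 = z 1 * x 0 * N * M^2 * s 0 / t 0^2"
    using z_nonzero nonzero
    by (simp add: ts_calc ts1 del: One_nat_def)
  have ts3: "t 3 = z 2 * x 0 * N * M^2 / t 0"
    using z_nonzero nonzero
    by (simp add: ts_calc ts1 ts2 del: One_nat_def)
  have ts4: "s 4 = z 3 * z 2 * N^2 * M^2 / s 0"
    using z_nonzero nonzero
    by (simp add: ts_calc ts2 ts3 del: One_nat_def)
  have ts5: "t 5 = z 2 * N * M * t 0 / s 0"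
    using z_nonzero nonzero
    by (simp add: ts_calc ts3 ts4 del: One_nat_def)
  have ts6: "s 6 = z 0 * N * t 0^2 / (x 0 * s 0)"
    using z_nonzero nonzero
    by (simp add: ts_calc ts4 ts5 del: One_nat_def)
  have ts7: "t 7 = t 0"
    using z_nonzero nonzero
    by (simp add: ts_calc ts5 ts6 del: One_nat_def)
  have ts8: "s 8 = s 0"
    using z_nonzero nonzero
    by (simp add: ts_calc ts6 ts7 del: One_nat_def)
  \<comment> \<open>The numerator amounts to
    \<open>a 0 * (z 2 - z 3) + (a 0 + b 0) * (z 1 - z 0)\<close>, which vanishes after inserting the
    linear forms.\<close>
  have X: "X 8 = 0"
    using z_nonzero nonzero
    by (simp add: XY_steps init x ab z_alias field_simps del: One_nat_def)
      (simp add: z algebra_simps del: One_nat_def)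
  have Y: "Y 8 = 0"
    using z_nonzero nonzero
    by (simp add: XY_steps init x ab y_eq z_alias field_simps del: One_nat_def)
      (simp add: z algebra_simps del: One_nat_def)
  show ?thesis
    using EF X Y ts7 ts8 unfolding closed_at_def
    by (simp add: ts_steps del: One_nat_def)
qed

text \<open>Here six letters act as -1 on the roots. The symbols that remain are \<open>z\<close> at
  0, 1, 2, 3, 5 and 7, and \<open>x\<close> again telescopes to \<open>x 0 * z 2\<close> over one of
  them.\<close>

lemma closed_G2:
  assumes "k = 3" "q = 1" "u = - 3 * v"
  shows "closed_at 12"
proof -
  have ab: "a 1 = - a 0" "b 1 = 3 * a 0 + b 0" "a 2 = 2 * a 0 + b 0" "b 2 = - 3 * a 0 - b 0"
    "a 3 = - 2 * a 0 - b 0" "b 3 = 3 * a 0 + 2 * b 0" "a 4 = a 0 + b 0"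
    "b 4 = - 3 * a 0 - 2 * b 0" "a 5 = - a 0 - b 0" "b 5 = b 0" "a 6 = - a 0" "b 6 = - b 0"
    "a 7 = a 0" "b 7 = - 3 * a 0 - b 0" "a 8 = - 2 * a 0 - b 0" "b 8 = 3 * a 0 + b 0"
    "a 9 = 2 * a 0 + b 0" "b 9 = - 3 * a 0 - 2 * b 0" "a 10 = - a 0 - b 0"
    "b 10 = 3 * a 0 + 2 * b 0" "a 11 = a 0 + b 0" "b 11 = - b 0"
    by (simp_all add: linear_steps assms algebra_simps del: One_nat_def)
  have EF: "E 12 = 0" "F 12 = 0"
    by (simp_all add: linear_steps init ab del: One_nat_def)
  have z: "z 1 = z 0 - 3 * a 0 * v" "z 2 = z 0 + b 0 * v" "z 3 = z 0 - 6 * a 0 * v - 2 * b 0 * v"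
    "z 4 = z 1" "z 5 = z 0 - 6 * a 0 * v - 3 * b 0 * v" "z 6 = z 3"
    "z 7 = z 0 - 3 * a 0 * v - 2 * b 0 * v" "z 8 = z 5" "z 9 = z 0" "z 10 = z 7" "z 11 = z 2"
    "z 12 = z 0"
    by (simp_all add: linear_steps ab assms algebra_simps del: One_nat_def)
  note z_alias = z(4,6,8-12)
  have x: "x 1 = x 0" "x 2 = x 0 * z 2 / z 1" "x 3 = x 0 * z 2 / z 1" "x 4 = x 0 * z 2 / z 3"
    "x 5 = x 0 * z 2 / z 3" "x 6 = x 0 * z 2 / z 5" "x 7 = x 0 * z 2 / z 5"
    "x 8 = x 0 * z 2 / z 7" "x 9 = x 0 * z 2 / z 7" "x 10 = x 0 * z 2 / z 0"
    "x 11 = x 0 * z 2 / z 0"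
    using z_nonzero nonzero by (simp_all add: x_steps z_alias del: One_nat_def)
  note ts_calc = ts_steps y_eq x z_alias assms field_simps power_numeral_reduce
  have ts1: "t 1 = x 0 * M * s 0 / t 0"
    using z_nonzero nonzero
    by (simp add: ts_calc del: One_nat_def)
  have ts2: "s 2 = z 1 * x 0^2 * N * M^3 * s 0^2 / t 0^3"
    using z_nonzero nonzero
    by (simp add: ts_calc ts1 del: One_nat_def)
  have ts3: "t 3 = z 2 * x 0^2 * N * M^3 * s 0 / t 0^2"
    using z_nonzero nonzero
    by (simp add: ts_calc ts1 ts2 del: One_nat_def)
  have ts4: "s 4 = z 3 * z 2^2 * x 0^3 * N^3 * M^6 * s 0 / t 0^3"
    using z_nonzero nonzero
    by (simp add: ts_calc ts2 ts3 del: One_nat_def)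
  have ts5: "t 5 = z 2^2 * x 0^2 * N^2 * M^4 / t 0"
    using z_nonzero nonzero
    by (simp add: ts_calc ts3 ts4 del: One_nat_def)
  have ts6: "s 6 = z 5 * z 2^3 * x 0^2 * N^4 * M^6 / s 0"
    using z_nonzero nonzero
    by (simp add: ts_calc ts4 ts5 del: One_nat_def)
  have ts7: "t 7 = z 2^2 * x 0 * N^2 * M^3 * t 0 / s 0"
    using z_nonzero nonzero
    by (simp add: ts_calc ts5 ts6 del: One_nat_def)
  have ts8: "s 8 = z 7 * z 2^2 * N^3 * M^3 * t 0^3 / s 0^2"
    using z_nonzero nonzero
    by (simp add: ts_calc ts6 ts7 del: One_nat_def)
  have ts9: "t 9 = z 2 * N * M * t 0^2 / s 0"
    using z_nonzero nonzero
    by (simp add: ts_calc ts7 ts8 del: One_nat_def)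
  have ts10: "s 10 = z 0 * N * t 0^3 / (x 0 * s 0)"
    using z_nonzero nonzero
    by (simp add: ts_calc ts8 ts9 del: One_nat_def)
  have ts11: "t 11 = t 0"
    using z_nonzero nonzero
    by (simp add: ts_calc ts9 ts10 del: One_nat_def)
  have ts12: "s 12 = s 0"
    using z_nonzero nonzero
    by (simp add: ts_calc ts10 ts11 del: One_nat_def)
  have X: "X 12 = 0"
    using z_nonzero nonzero
    by (simp add: XY_steps init x ab z_alias field_simps del: One_nat_def)
      (simp add: z algebra_simps del: One_nat_def)
  have Y: "Y 12 = 0"
    using z_nonzero nonzero
    by (simp add: XY_steps init x ab y_eq z_alias field_simps del: One_nat_def)
      (simp add: z algebra_simps del: One_nat_def)
  show ?thesis
    using EF X Y ts11 ts12 unfolding closed_at_def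
    by (simp add: ts_steps del: One_nat_def)
qed

end

section \<open>The automorphisms attached to a Cartan matrix\<close>

lemma rvar_nonzero [simp]: "rvar v \<noteq> 0"
proof -
  have "Poly_Mapping.single (Poly_Mapping.single v 1) (1::complex) \<noteq> 0"
    by (metis lookup_single_eq lookup_zero zero_neq_one)
  then show ?thesis by (simp add: rvar_def Zero_fract_def eq_fract del: One_nat_def)
qed

text \<open>New letters are put on the right and act first on the argument. So
  \<open>w (Suc n)\<close> on a variable is \<open>w n\<close> applied to the explicit image under
  one generator.\<close>

primrec alternating :: "('a \<Rightarrow> 'a) \<Rightarrow> ('a \<Rightarrow> 'a) \<Rightarrow> nat \<Rightarrow> 'a \<Rightarrow> 'a" where
  "alternating g h 0 = id"
| "alternating g h (Suc n) = alternating g h n \<circ> (if even n then g else h)"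

lemma alternating_double: "alternating g h (2 * n) = (g \<circ> h) ^^ n"
  by (induction n) (simp_all add: funpow_Suc_right comp_assoc del: funpow.simps(2))

text \<open>Conjugation by \<open>g\<close> turns powers of \<open>h \<circ> g\<close> into powers
  of \<open>g \<circ> h\<close>. This exchanges the two indices when the Cartan entry -1 sits on the
  other side.\<close>

lemma funpow_comp_commute_eq_id:
  assumes "g \<circ> g = id" "h \<circ> h = id" "(h \<circ> g) ^^ n = id"
  shows "(g \<circ> h) ^^ n = id"
proof -
  have "(g \<circ> h) ^^ n = g \<circ> (h \<circ> g) ^^ n \<circ> g"
  proof (induction n)
    case (Suc n)
    have "g \<circ> (h \<circ> g) ^^ Suc n \<circ> g = (g \<circ> h) \<circ> (g \<circ> (h \<circ> g) ^^ n \<circ> g)"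
      by (simp add: comp_assoc)
    with Suc show ?case by simp
  qed (simp add: assms)
  then show ?thesis by (simp add: assms)
qed

section \<open>A single generator: its values at the variables and its square\<close>

locale weyl_data =
  fixes A :: "'i::{finite,linorder} \<Rightarrow> 'i \<Rightarrow> int" and U :: "'i \<Rightarrow> 'i \<Rightarrow> complex"
  assumes diag_A: "A i i = 2" and diag_U: "U i i = 0"
begin

lemma s_img_Alpha: "s_img A U i (Alpha, j) = rvar (Alpha, j) - of_int (A i j) * rvar (Alpha, i)"
  and s_img_Fv: "s_img A U i (Fv, j) = rvar (Fv, j) + rvar (Alpha, i) / rvar (Fv, i) * rconst (U i j)"
  and s_img_Tau_other: "j \<noteq> i \<Longrightarrow> s_img A U i (Tau, j) = rvar (Tau, j)"
  by (simp_all add: s_img_def)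

text \<open>The factor at \<open>k = i\<close> has exponent -2 and turns \<open>\<tau>_i\<close>
  into its inverse. The remaining product is free of \<open>\<tau>_i\<close>, hence fixed by the
  substitution.\<close>

lemma s_img_Tau:
  "s_img A U i (Tau, i) = rvar (Fv, i) * (\<Prod>k\<in>UNIV - {i}. rvar (Tau, k) powi (- A k i)) / rvar (Tau, i)"
  by (simp add: s_img_def prod.remove[of UNIV i] diag_A power_int_minus power_int_def
      power2_eq_square field_simps)

text \<open>The substitution negates \<open>\<alpha>_i\<close> and fixes \<open>f_i\<close>, so a
  second application undoes each correction term, and \<open>\<tau>_i\<close> is inverted twice
  against the same factor.\<close>

sublocale involutive_substitution "s_img A U i" for i
proof
  let ?\<sigma> = "s_img A U i"
  have f: "?\<sigma> (Fv, i) = rvar (Fv, i)" and a: "?\<sigma> (Alpha, i) = - rvar (Alpha, i)"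
    by (simp_all add: s_img_Fv s_img_Alpha diag_U diag_A)
  fix v show "has_value ?\<sigma> (?\<sigma> v) (rvar v)"
  proof (cases v)
    case (Pair kind j)
    show ?thesis
    proof (cases kind)
      case Alpha
      have "has_value ?\<sigma> (rvar (Alpha, j) - of_int (A i j) * rvar (Alpha, i))
          (?\<sigma> (Alpha, j) - of_int (A i j) * ?\<sigma> (Alpha, i))"
        by (intro has_value_diff has_value_mult has_value_of_int has_value_rvar)
      then show ?thesis by (simp add: Pair Alpha a s_img_Alpha[of i j])
    next
      case Fv
      have "has_value ?\<sigma> (rvar (Fv, j) + rvar (Alpha, i) / rvar (Fv, i) * rconst (U i j))
          (?\<sigma> (Fv, j) + ?\<sigma> (Alpha, i) / ?\<sigma> (Fv, i) * rconst (U i j))"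
        by (intro has_value_add has_value_mult has_value_divide has_value_rconst has_value_rvar)
          (simp add: f)
      then show ?thesis by (simp add: Pair Fv a f s_img_Fv[of i j])
    next
      case Tau
      show ?thesis
      proof (cases "j = i")
        case True
        let ?M = "\<Prod>k\<in>UNIV - {i}. rvar (Tau, k) powi (- A k i)"
        have "has_value ?\<sigma> ?M (\<Prod>k\<in>UNIV - {i}. ?\<sigma> (Tau, k) powi (- A k i))"
          by (intro has_value_prod has_value_powi has_value_rvar) (simp add: s_img_Tau_other)
        also have "(\<Prod>k\<in>UNIV - {i}. ?\<sigma> (Tau, k) powi (- A k i)) = ?M"
          by (intro prod.cong) (simp_all add: s_img_Tau_other)
        finally have "has_value ?\<sigma> ?M ?M" .
        moreover have M: "?M \<noteq> 0" by simp
        ultimately have "has_value ?\<sigma> (rvar (Fv, i) * ?M / rvar (Tau, i))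
            (?\<sigma> (Fv, i) * ?M / ?\<sigma> (Tau, i))"
          by (intro has_value_mult has_value_divide has_value_rvar) (simp_all add: s_img_Tau)
        with M show ?thesis by (simp add: Pair Tau True f s_img_Tau)
      qed (use has_value_rvar[of ?\<sigma> "(Tau, j)"] in \<open>simp add: Pair Tau s_img_Tau_other\<close>)
    qed
  qed
qed

lemma s_aut_hom: "ratfun_hom (s_aut A U i)"
  unfolding s_aut_def by (rule ratfun_hom_rsubst)

lemma s_aut_rvar: "s_aut A U i (rvar v) = s_img A U i v"
  unfolding s_aut_def by (rule rsubst_eqI, rule has_value_rvar)

lemma s_aut_involution: "s_aut A U i \<circ> s_aut A U i = id"
  by (simp add: fun_eq_iff s_aut_def rsubst_rsubst)

context
  fixes w :: "'i ratfun \<Rightarrow> 'i ratfun"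
  assumes w: "ratfun_hom w"
begin

lemma hom_s_aut_Alpha:
  "w (s_aut A U i (rvar (Alpha, j))) = w (rvar (Alpha, j)) - of_int (A i j) * w (rvar (Alpha, i))"
  by (simp add: s_aut_rvar s_img_Alpha hom_diff[OF w] hom_mult[OF w] hom_of_int[OF w])

lemma hom_s_aut_Fv:
  "w (s_aut A U i (rvar (Fv, j)))
     = w (rvar (Fv, j)) + w (rvar (Alpha, i)) / w (rvar (Fv, i)) * rconst (U i j)"
  by (simp add: s_aut_rvar s_img_Fv hom_add[OF w] hom_mult[OF w] hom_divide[OF w] hom_rconst[OF w])

lemma hom_s_aut_Tau:
  "w (s_aut A U i (rvar (Tau, i)))
     = w (rvar (Fv, i)) * (\<Prod>k\<in>UNIV - {i}. w (rvar (Tau, k)) powi (- A k i)) / w (rvar (Tau, i))"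
  by (simp add: s_aut_rvar s_img_Tau hom_mult[OF w] hom_divide[OF w] hom_prod[OF w] hom_powi[OF w])

end

lemma s_aut_Tau_other: "j \<noteq> i \<Longrightarrow> s_aut A U i (rvar (Tau, j)) = rvar (Tau, j)"
  by (simp add: s_aut_rvar s_img_Tau_other)

lemma alternating_eq_id:
  assumes ij: "i \<noteq> j" and A_ij: "A i j = - int k" and A_ji: "A j i = - int q"
    and kq: "k = 0 \<and> q = 0 \<and> U i j = 0 \<and> U j i = 0 \<and> m = 2
      \<or> q = 1 \<and> U i j = - of_nat k * U j i \<and> (k, m) \<in> {(1, 3), (2, 4), (3, 6)}"
  shows "alternating (s_aut A U i) (s_aut A U j) (2 * m) = id"
proof -
  define w where "w = alternating (s_aut A U i) (s_aut A U j)"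
  have w_hom: "ratfun_hom (w n)" for n
    by (induction n) (use s_aut_hom in \<open>simp_all add: w_def ratfun_hom_def\<close>)
  have w_0: "w 0 r = r" for r
    by (simp add: w_def)
  have w_even: "w (Suc n) r = w n (s_aut A U i r)" if "even n" for n r
    using that by (simp add: w_def)
  have w_odd: "w (Suc n) r = w n (s_aut A U j r)" if "odd n" for n r
    using that by (simp add: w_def)
  have w_tau: "w n (rvar (Tau, l)) = rvar (Tau, l)" if "l \<noteq> i" "l \<noteq> j" for n l
    by (induction n) (simp_all add: w_def s_aut_Tau_other that)
  note step_simps = w_even w_odd hom_s_aut_Alpha[OF w_hom] hom_s_aut_Fv[OF w_hom]
    hom_s_aut_Tau[OF w_hom] s_aut_Tau_other

  \<comment> \<open>The letter added at position \<open>l\<close> is \<open>s_i\<close> for even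
    \<open>l\<close> and \<open>s_j\<close> for odd \<open>l\<close>; each sum collects the
    contributions of one letter.\<close>
  define E F X Y where
    "E n = (\<Sum>l<n. if even l then w l (rvar (Alpha, i)) else 0)" and
    "F n = (\<Sum>l<n. if even l then 0 else w l (rvar (Alpha, j)))" and
    "X n = (\<Sum>l<n. if even l then w l (rvar (Alpha, i)) / w l (rvar (Fv, i)) else 0)" and
    "Y n = (\<Sum>l<n. if even l then 0 else w l (rvar (Alpha, j)) / w l (rvar (Fv, j)))" for n
  note EFXY = E_def F_def X_def Y_def
  have w_Alpha: "w n (rvar (Alpha, l)) = rvar (Alpha, l) - of_int (A i l) * E n - of_int (A j l) * F n" for n l
    by (induction n) (simp_all add: w_0 EFXY step_simps algebra_simps)
  have w_Fv: "w n (rvar (Fv, l)) = rvar (Fv, l) + rconst (U i l) * X n + rconst (U j l) * Y n" for n l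
    by (induction n) (simp_all add: w_0 EFXY step_simps algebra_simps)

  define M N where "M = (\<Prod>l\<in>UNIV - {i, j}. rvar (Tau, l) powi (- A l i))"
    and "N = (\<Prod>l\<in>UNIV - {i, j}. rvar (Tau, l) powi (- A l j))"
  \<comment> \<open>Among the factors other than \<open>\<tau>_i\<close> only
    \<open>\<tau>_j\<close> moves along the word; its exponent is the natural number
    \<open>q\<close>, and the rest is the constant \<open>M\<close>.\<close>
  have M: "(\<Prod>l\<in>UNIV - {i}. w n (rvar (Tau, l)) powi (- A l i)) = M * w n (rvar (Tau, j)) ^ q" for n
  proof -
    have "UNIV - {i} - {j} = UNIV - {i, j}" by auto
    moreover have "(\<Prod>l\<in>UNIV - {i, j}. w n (rvar (Tau, l)) powi (- A l i)) = M"
      unfolding M_def by (intro prod.cong) (simp_all add: w_tau)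
    ultimately show ?thesis
      using ij by (simp add: prod.remove[of "UNIV - {i}" j] A_ji)
  qed
  have N: "(\<Prod>l\<in>UNIV - {j}. w n (rvar (Tau, l)) powi (- A l j)) = N * w n (rvar (Tau, i)) ^ k" for n
  proof -
    have "UNIV - {j} - {i} = UNIV - {i, j}" by auto
    moreover have "(\<Prod>l\<in>UNIV - {i, j}. w n (rvar (Tau, l)) powi (- A l j)) = N"
      unfolding N_def by (intro prod.cong) (simp_all add: w_tau)
    ultimately show ?thesis
      using ij by (simp add: prod.remove[of "UNIV - {j}" i] A_ij)
  qed

  interpret orbit: rank_two_orbit k q "rconst (U i j)" "rconst (U j i)" M N
    "\<lambda>n. w n (rvar (Alpha, i))" "\<lambda>n. w n (rvar (Alpha, j))"
    "\<lambda>n. w n (rvar (Fv, i))" "\<lambda>n. w n (rvar (Fv, j))"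
    E F X Y "\<lambda>n. w n (rvar (Tau, i))" "\<lambda>n. w n (rvar (Tau, j))"
  \<comment> \<open>The values of \<open>w n\<close> at variables are nonzero because field
    homomorphisms are injective.\<close>
  proof
    show "M \<noteq> 0" "N \<noteq> 0" by (simp_all add: M_def N_def)
  qed (use ij in \<open>simp_all add: hom_eq_0_iff[OF w_hom] EFXY step_simps M N A_ij A_ji diag_A diag_U\<close>)

  have "orbit.closed_at (2 * m)"
    using kq
  proof (elim disjE conjE)
    assume "k = 0" "q = 0" "U i j = 0" "U j i = 0" "m = 2"
    then show ?thesis using orbit.closed_A1A1 by simp
  next
    assume q: "q = 1" and U: "U i j = - of_nat k * U j i" and km: "(k, m) \<in> {(1, 3), (2, 4), (3, 6)}"
    have "rconst (U i j) = - of_nat k * rconst (U j i)"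
      by (simp add: U rconst_mult rconst_minus of_int_eq_rconst[of "int k", simplified])
    with q km show ?thesis
      using orbit.closed_A2 orbit.closed_B2 orbit.closed_G2 by auto
  qed
  then have closed: "E (2 * m) = 0" "F (2 * m) = 0" "X (2 * m) = 0" "Y (2 * m) = 0"
    "w (2 * m) (rvar (Tau, i)) = rvar (Tau, i)" "w (2 * m) (rvar (Tau, j)) = rvar (Tau, j)"
    by (auto simp: orbit.closed_at_def w_0)
  have "w (2 * m) (rvar (kind, l)) = rvar (kind, l)" for kind l
  proof (cases kind)
    case Tau
    then show ?thesis by (cases "l = i \<or> l = j") (auto simp: closed w_tau)
  qed (simp_all add: w_Alpha w_Fv closed)
  then show ?thesis
    unfolding w_def[symmetric] by (intro hom_eq_id[OF w_hom]) (simp add: split_paired_all)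
qed

end

theorem theorem2:
  fixes A :: "'i::{finite,linorder} \<Rightarrow> 'i \<Rightarrow> int" and U :: "'i \<Rightarrow> 'i \<Rightarrow> complex"
  assumes "gcm A"
    and "\<forall>j. U j j = 0"
    and "\<forall>i j. A i j = 0 \<and> A j i = 0 \<longrightarrow> U i j = 0 \<and> U j i = 0"
    and "\<forall>i j k. k \<in> {1,2,3} \<and> A i j = - k \<and> A j i = -1 \<longrightarrow> U i j = - of_int k * U j i"
  shows "(\<forall>i. s_aut A U i \<circ> s_aut A U i = id) \<and>
         (\<forall>i j n. i \<noteq> j \<and> coxeter_m A i j = Some n \<longrightarrow>
            (s_aut A U i \<circ> s_aut A U j) ^^ n = id)"
proof -
  interpret weyl_data A U
    using assms by unfold_locales (auto simp: gcm_def)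
  have id: "(s_aut A U i \<circ> s_aut A U j) ^^ m = id"
    if "i \<noteq> j" "A i j = - int k" "A j i = - 1" "(k, m) \<in> {(1, 3), (2, 4), (3, 6)}" for i j k m
  proof -
    have "U i j = - of_int (int k) * U j i"
      using assms(4)[rule_format, of "int k" i j] that by auto
    then show ?thesis
      using alternating_eq_id[of i j k 1 m] that by (simp add: alternating_double)
  qed
  have "(s_aut A U i \<circ> s_aut A U j) ^^ n = id" if "i \<noteq> j" "coxeter_m A i j = Some n" for i j n
  proof (cases "A i j = 0")
    case True
    then have "A j i = 0" using assms(1) by (simp add: gcm_def)
    moreover have "n = 2" using that True by (simp add: coxeter_m_def)
    ultimately show ?thesis
      using alternating_eq_id[of i j 0 0 2] that True assms(3)
      by (simp del: funpow.simps flip: alternating_double)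
  next
    case False
    define k q where "k = nat (- A i j)" and "q = nat (- A j i)"
    have "A i j \<le> 0" "A j i \<le> 0" "A j i \<noteq> 0"
      using assms(1) \<open>i \<noteq> j\<close> False by (auto simp: gcm_def)
    then have kq: "A i j = - int k" "A j i = - int q" "k > 0" "q > 0"
      using False by (auto simp: k_def q_def)
    have "A i j * A j i = int (k * q)" by (simp add: kq)
    with that have n: "(k * q, n) \<in> {(1, 3), (2, 4), (3, 6)}"
      using kq(3,4) by (auto simp: coxeter_m_def Let_def simp del: of_nat_mult split: if_splits)
    \<comment> \<open>Two positive integers with product at most 3 cannot both exceed 1.\<close>
    moreover have "k \<le> k * q" "q \<le> k * q" "k * q \<le> 3" using kq n by auto
    then have "k \<le> 3" "q \<le> 3" by linarith+
    then have "k = 1 \<or> k = 2 \<or> k = 3" "q = 1 \<or> q = 2 \<or> q = 3"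
      using kq(3,4) by presburger+
    ultimately have "q = 1 \<and> (k, n) \<in> {(1, 3), (2, 4), (3, 6)}
        \<or> k = 1 \<and> (q, n) \<in> {(1, 3), (2, 4), (3, 6)}"
      by auto
    \<comment> \<open>If \<open>q = 1\<close>, then \<open>id\<close> applies directly; if
      \<open>k = 1\<close>, it applies to \<open>s_j s_i\<close>, and conjugation by an involution
      transfers the relation.\<close>
    then show ?thesis
      using id[of i j k n] funpow_comp_commute_eq_id[OF s_aut_involution s_aut_involution id[of j i q n]]
        that kq by auto
  qed
  then show ?thesis using s_aut_involution by blast
qed

end
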